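(* Let $a$ be a positive integer and let $p$ be a real number with $1\le p<\infty$ and $2p>a$. Then there is a constant $c_{p,a}$, depending only on $p$ and $a$, such that for every positive integer $n$ and all positive integers $a_1,\ldots,a_n$ with $\max_{1\le i\le n}a_i=a$, $$e(\mathbb{E}^{a_1}\oplus_p\cdots\oplus_p\mathbb{E}^{a_n})\le c_{p,a}\,n^{\frac{2p+2a}{2p-a}}.$$
   Context: $\mathbb{E}^k$ denotes $\mathbb{R}^k$ with the standard Euclidean norm $\|\cdot\|$. For real $p\ge 1$, the space $\mathbb{E}^{a_1}\oplus_p\cdots\oplus_p\mathbb{E}^{a_n}$ is the product $\mathbb{E}^{a_1}\times\cdots\times\mathbb{E}^{a_n}$ equipped with the norm $\|(x_1,\ldots,x_n)\|_p=\left(\sum_{i=1}^n\|x_i\|^p\right)^{1/p}$, where $x_i\in\mathbb{E}^{a_i}$, and distance $\|x-y\|_p$. A subset $S$ of a normed space is an equilateral set if the distances between distinct points of $S$ take only one value. $e(X)$ denotes the maximum cardinality of an equilateral set in $X$; thus $e(X)\le N$ means that every equilateral set in $X$ has at most $N$ points. *)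

theory Defs
  imports "HOL-Analysis.L2_Norm"
begin

text \<open>
  The number of summands and their dimensions vary inside the theorem, so the spaces are given by
  explicit carriers rather than by types: a vector of $k$-space is a sequence supported on the
  coordinates $0, \dots, k - 1$, and likewise for the summands of a direct sum (indexed from 0).
  The support condition makes equality in the carrier the same as equality of the coordinates that
  matter, so that cardinalities and distinctness of points have their usual meaning.
\<close>

definition euclidean_carrier :: "nat \<Rightarrow> (nat \<Rightarrow> real) set" where
  "euclidean_carrier k = {x. \<forall>j\<ge>k. x j = 0}"

definition euclidean_norm :: "nat \<Rightarrow> (nat \<Rightarrow> real) \<Rightarrow> real" where
  "euclidean_norm k x = L2_set x {..<k}"

definition psum_carrier :: "nat \<Rightarrow> (nat \<Rightarrow> nat) \<Rightarrow> (nat \<Rightarrow> nat \<Rightarrow> real) set" where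
  "psum_carrier n d =
     {x. (\<forall>i<n. x i \<in> euclidean_carrier (d i)) \<and> (\<forall>i\<ge>n. x i = (\<lambda>j. 0))}"

definition psum_norm :: "real \<Rightarrow> nat \<Rightarrow> (nat \<Rightarrow> nat) \<Rightarrow> (nat \<Rightarrow> nat \<Rightarrow> real) \<Rightarrow> real" where
  "psum_norm p n d x = (\<Sum>i<n. euclidean_norm (d i) (x i) powr p) powr (1 / p)"

definition psum_dist ::
    "real \<Rightarrow> nat \<Rightarrow> (nat \<Rightarrow> nat) \<Rightarrow> (nat \<Rightarrow> nat \<Rightarrow> real) \<Rightarrow> (nat \<Rightarrow> nat \<Rightarrow> real) \<Rightarrow> real" where
  "psum_dist p n d x y = psum_norm p n d (\<lambda>i j. x i j - y i j)"

definition equilateral :: "('a \<Rightarrow> 'a \<Rightarrow> real) \<Rightarrow> 'a set \<Rightarrow> bool" where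
  "equilateral D S \<longleftrightarrow> (\<exists>r. \<forall>x\<in>S. \<forall>y\<in>S. x \<noteq> y \<longrightarrow> D x y = r)"

text \<open>
  The bound \<open>e(X) \<le> N\<close> on the maximum cardinality of an equilateral set. Finiteness is required
  explicitly because \<open>card\<close> is 0 on infinite sets.
\<close>

definition equilateral_number_le :: "'a set \<Rightarrow> ('a \<Rightarrow> 'a \<Rightarrow> real) \<Rightarrow> real \<Rightarrow> bool" where
  "equilateral_number_le X D N \<longleftrightarrow>
     (\<forall>S. S \<subseteq> X \<and> equilateral D S \<longrightarrow> finite S \<and> real (card S) \<le> N)"

end

theory Submission
  imports
    Defs
    "HOL-Analysis.Gamma_Function"
    "HOL-Analysis.Generalised_Binomial_Theorem"
    "HOL-Computational_Algebra.Polynomial"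
begin

text \<open>
  The argument is that of Alon and Pudlak for $a = 1$. On $[0,1]$ the function $s^{p/2}$ is
  within $O(k^{-p})$ of a polynomial $Q$ of degree at most $k$. For $m$ points at mutual distance
  $r$, the matrix $1 - \sum_l Q(\|x_l - y_l\|^2 / r^2)$ is then within $O(n k^{-p})$ of the
  identity, and its columns lie in a space of functions of dimension at most $n (2k+1)^a$. A matrix
  whose entries are within $1/(2\sqrt m)$ of the identity has rank at least $m/10$, so taking $k$ of order
  $(n \sqrt m)^{1/p}$ gives $m = O(n (n \sqrt m)^{a/p})$, which is solved for $m$ because $a < 2p$.

  The polynomial $Q$ comes from the binomial series of $(1 - (1-s))^{p/2}$ cut off at degree $k^2$,
  in which each power of $1-s$ is replaced by its Chebyshev expansion cut off at degree $k$.
\<close>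

subsection \<open>Polynomial approximation of powers\<close>

text \<open>Termwise comparison of the two power series, by (2n)! >= n!. It serves to bound
  \<open>cosh t ^ j\<close>, the moment generating function of a sum of j random signs.\<close>

lemma cosh_le_exp_power2: "cosh x \<le> exp (x\<^sup>2)" for x :: real
proof -
  \<comment> \<open>Reindexing by doubling drops the vanishing odd terms of the series.\<close>
  have "(\<lambda>n. x ^ (2 * n) /\<^sub>R fact (2 * n)) sums cosh x"
    using cosh_converges[of x]
    by (subst (asm) sums_mono_reindex[of "(*) 2", symmetric]) (auto simp: strict_mono_def elim!: evenE)
  moreover have "(\<lambda>n. (x\<^sup>2) ^ n /\<^sub>R fact n) sums exp (x\<^sup>2)"
    by (rule exp_converges)
  moreover have "x ^ (2 * n) /\<^sub>R fact (2 * n) \<le> (x\<^sup>2) ^ n /\<^sub>R fact n" for n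
  proof -
    have "inverse (fact (2 * n)) \<le> (inverse (fact n) :: real)"
      by (intro le_imp_inverse_le fact_mono) auto
    then show ?thesis
      by (simp add: power_mult mult_right_mono)
  qed
  ultimately show ?thesis
    by (meson sums_le)
qed

text \<open>Chernoff's method: the left side is the probability that a sum of j independent signs
  exceeds k in absolute value, and its moment generating function at t is at most exp (j
  t^2).\<close>

lemma binomial_tail_bound:
  assumes "j \<ge> 1"
  shows "(\<Sum>i \<in> {i. i \<le> j \<and> \<bar>real j - 2 * real i\<bar> > real k}. real (j choose i)) / 2 ^ j
           \<le> 2 * exp (- (real k)\<^sup>2 / (4 * real j))"
proof -
  \<comment> \<open>The minimiser of the exponent \<open>- l * k + j * l^2\<close> reached at the
    end.\<close>
  define l where "l = real k / (2 * real j)"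
  let ?A = "{i. i \<le> j \<and> \<bar>real j - 2 * real i\<bar> > real k}"
  let ?d = "\<lambda>i. real j - 2 * real i"
  have l0: "l \<ge> 0" by (simp add: l_def)
  have mgf: "(\<Sum>i\<le>j. real (j choose i) * exp (t * ?d i)) = 2 ^ j * cosh t ^ j" for t
  proof -
    have "2 ^ j * cosh t ^ j = (exp (- t) + exp t) ^ j"
    proof -
      have "2 * cosh t = exp (- t) + exp t" by (simp add: cosh_def)
      then show ?thesis by (metis power_mult_distrib)
    qed
    also have "\<dots> = (\<Sum>i\<le>j. real (j choose i) * exp (- t) ^ i * exp t ^ (j - i))"
      by (simp add: binomial_ring)
    also have "\<dots> = (\<Sum>i\<le>j. real (j choose i) * exp (t * ?d i))"
      by (intro sum.cong refl)
         (auto simp: exp_of_nat_mult[symmetric] mult_exp_exp of_nat_diff algebra_simps)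
    finally show ?thesis by simp
  qed
  \<comment> \<open>On \<open>?A\<close> the inserted weight is at least exp (l (|d| - k)) >= 1,
    where d = j - 2i. Adding the exponentials of both signs treats both tails at once.\<close>
  have "(\<Sum>i\<in>?A. real (j choose i)) \<le>
      (\<Sum>i\<in>?A. real (j choose i) * (exp (- l * k) * (exp (l * ?d i) + exp (- l * ?d i))))"
  proof (intro sum_mono)
    fix i assume i: "i \<in> ?A"
    have "1 \<le> exp (- l * k + l * \<bar>?d i\<bar>)"
      using i l0 by (simp add: mult_left_mono)
    also have "l * \<bar>?d i\<bar> = \<bar>l * ?d i\<bar>"
      using l0 by (simp add: abs_mult)
    also have "exp (- l * k + \<bar>l * ?d i\<bar>) \<le> exp (- l * k) * (exp (l * ?d i) + exp (- (l * ?d i)))"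
      unfolding exp_add by (intro mult_left_mono) (simp_all add: abs_if)
    finally have "1 \<le> exp (- l * k) * (exp (l * ?d i) + exp (- l * ?d i))"
      by simp
    then show "real (j choose i) \<le>
        real (j choose i) * (exp (- l * k) * (exp (l * ?d i) + exp (- l * ?d i)))"
      by (metis mult_left_mono mult.right_neutral of_nat_0_le_iff)
  qed
  also have "\<dots> \<le>
      (\<Sum>i\<le>j. real (j choose i) * (exp (- l * k) * (exp (l * ?d i) + exp (- l * ?d i))))"
    by (intro sum_mono2) auto
  also have "\<dots> = exp (- l * k) * ((\<Sum>i\<le>j. real (j choose i) * exp (l * ?d i)) +
                       (\<Sum>i\<le>j. real (j choose i) * exp (- l * ?d i)))"
    by (simp add: sum_distrib_left sum.distrib algebra_simps)
  also have "\<dots> = 2 ^ j * (2 * (exp (- l * k) * cosh l ^ j))"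
    using mgf[of l] mgf[of "- l"] by (simp add: algebra_simps)
  finally have "(\<Sum>i\<in>?A. real (j choose i)) / 2 ^ j \<le> 2 * (exp (- l * k) * cosh l ^ j)"
    by (simp add: field_simps)
  also have "exp (- l * k) * cosh l ^ j \<le> exp (- l * k) * exp (l\<^sup>2) ^ j"
    by (intro mult_left_mono power_mono cosh_le_exp_power2) auto
  also have "\<dots> = exp (- l * k + j * l\<^sup>2)"
    by (simp only: exp_of_nat_mult exp_add)
  also have "- l * k + j * l\<^sup>2 = - (real k)\<^sup>2 / (4 * real j)"
    using assms by (simp add: l_def field_simps power2_eq_square)
  finally show ?thesis by simp
qed

section \<open>Chebyshev expansions of powers\<close>

text \<open>Real part of the binomial expansion of (exp (-it) + exp (it))^j = (2 cos t)^j. With x =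
  cos t this is the Chebyshev expansion of x^j, and its weights form the binomial
  distribution.\<close>

lemma cos_power_expansion:
  "cos t ^ j = (\<Sum>i\<le>j. real (j choose i) / 2 ^ j * cos ((real j - 2 * real i) * t))"
proof -
  have "cis (- t) + cis t = complex_of_real (2 * cos t)"
    by (simp add: complex_eq_iff)
  then have "(2 * cos t) ^ j = Re ((cis (- t) + cis t) ^ j)"
    by (simp only: Re_complex_of_real flip: of_real_power)
  also have "(cis (- t) + cis t) ^ j =
      (\<Sum>i\<le>j. of_nat (j choose i) * cis (- t) ^ i * cis t ^ (j - i))"
    by (simp add: binomial_ring)
  also have "\<dots> = (\<Sum>i\<le>j. of_nat (j choose i) * cis ((real j - 2 * real i) * t))"
  proof (intro sum.cong refl)
    fix i assume "i \<in> {..j}"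
    then have "real i * - t + real (j - i) * t = (real j - 2 * real i) * t"
      by (simp add: of_nat_diff algebra_simps)
    then show "of_nat (j choose i) * cis (- t) ^ i * cis t ^ (j - i) =
        of_nat (j choose i) * cis ((real j - 2 * real i) * t)"
      by (simp only: Complex.DeMoivre cis_mult mult.assoc)
  qed
  finally have "cos t ^ j = (\<Sum>i\<le>j. real (j choose i) * cos ((real j - 2 * real i) * t)) / 2 ^ j"
    by (simp add: power_mult_distrib field_simps)
  then show ?thesis
    by (simp add: sum_divide_distrib)
qed

text \<open>The recursion T_(n+2) = 2 x T_(n+1) - T_n is the product formula for cosines.\<close>

lemma chebyshev_polynomial_exists:
  "\<exists>T :: real poly. degree T \<le> n \<and> (\<forall>t. poly T (cos t) = cos (real n * t))"
proof (induction n rule: less_induct)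
  case (less n)
  consider "n = 0" | "n = 1" | m where "n = Suc (Suc m)"
    by (metis One_nat_def not0_implies_Suc)
  then show ?case
  proof cases
    case 1
    then show ?thesis by (intro exI[of _ 1]) auto
  next
    case 2
    then show ?thesis by (intro exI[of _ "[:0, 1:]"]) auto
  next
    case 3
    obtain T U :: "real poly" where TU:
      "degree T \<le> m" "\<And>t. poly T (cos t) = cos (real m * t)"
      "degree U \<le> Suc m" "\<And>t. poly U (cos t) = cos (real (Suc m) * t)"
      using less[of m] less[of "Suc m"] 3 by auto
    have "degree ([:0, 2:] * U - T) \<le> n"
    proof (rule degree_diff_le)
      have "degree ([:0, 2:] * U) \<le> degree [:0, 2 :: real:] + degree U"
        by (rule degree_mult_le)
      then show "degree ([:0, 2:] * U) \<le> n" using TU 3 by simp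
    qed (use TU 3 in simp)
    moreover have "poly ([:0, 2:] * U - T) (cos t) = cos (real n * t)" for t
      using cos_times_cos[of "real (Suc m) * t" t] TU 3
      by (simp add: algebra_simps)
    ultimately show ?thesis by blast
  qed
qed

text \<open>Truncating the Chebyshev expansion of $x^j$ loses only a tail of the binomial distribution, so
  degree about $\sqrt j$ is enough.\<close>

lemma power_approx_low_degree:
  assumes "j \<ge> 1"
  shows "\<exists>P :: real poly. degree P \<le> k \<and>
           (\<forall>x\<in>{-1..1}. \<bar>x ^ j - poly P x\<bar> \<le> 2 * exp (- (real k)\<^sup>2 / (4 * real j)))"
proof -
  obtain T :: "nat \<Rightarrow> real poly" where
    T: "\<And>n. degree (T n) \<le> n" "\<And>n t. poly (T n) (cos t) = cos (real n * t)"
    using chebyshev_polynomial_exists by metis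
  \<comment> \<open>Cosine is even, so the frequency j - 2i may be replaced by its absolute value,
    the index of a Chebyshev polynomial. Integer subtraction avoids truncation at 0.\<close>
  define N where "N i = nat \<bar>int j - 2 * int i\<bar>" for i
  have N: "real (N i) = \<bar>real j - 2 * real i\<bar>" for i
    by (simp add: N_def)
  let ?A = "{i. i \<le> j \<and> \<bar>real j - 2 * real i\<bar> > real k}"
  let ?B = "{i. i \<le> j \<and> N i \<le> k}"
  define P where "P = (\<Sum>i\<in>?B. smult (real (j choose i) / 2 ^ j) (T (N i)))"
  have AB: "{..j} = ?A \<union> ?B" "?A \<inter> ?B = {}" "finite ?A" "finite ?B"
    by (auto simp flip: N)
  have "degree P \<le> k"
    unfolding P_def by (intro degree_sum_le) (use T AB in \<open>auto intro: order.trans\<close>)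
  moreover have "\<bar>x ^ j - poly P x\<bar> \<le> 2 * exp (- (real k)\<^sup>2 / (4 * real j))"
    if "x \<in> {-1..1}" for x
  proof -
    define t where "t = arccos x"
    have t: "x = cos t"
      using that by (simp add: t_def)
    have cosN: "cos (real (N i) * t) = cos ((real j - 2 * real i) * t)" for i
      unfolding N by (metis abs_if cos_minus mult_minus_left)
    have "x ^ j = (\<Sum>i\<in>?A \<union> ?B. real (j choose i) / 2 ^ j * cos (real (N i) * t))"
      using cos_power_expansion[of t j] AB(1) by (simp add: t cosN)
    also have "\<dots> = (\<Sum>i\<in>?A. real (j choose i) / 2 ^ j * cos (real (N i) * t)) + poly P x"
      using AB by (subst sum.union_disjoint) (auto simp: P_def poly_sum t T)
    finally have "\<bar>x ^ j - poly P x\<bar> =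
        \<bar>\<Sum>i\<in>?A. real (j choose i) / 2 ^ j * cos (real (N i) * t)\<bar>" by simp
    also have "\<dots> \<le> (\<Sum>i\<in>?A. \<bar>real (j choose i) / 2 ^ j * cos (real (N i) * t)\<bar>)"
      by (rule sum_abs)
    \<comment> \<open>Cosines are at most 1 in absolute value, so the discarded part is at most the
      binomial weight of \<open>?A\<close>.\<close>
    also have "\<dots> \<le> (\<Sum>i\<in>?A. real (j choose i) / 2 ^ j)"
      by (intro sum_mono) (auto simp: abs_mult mult_left_le divide_right_mono)
    also have "\<dots> \<le> 2 * exp (- (real k)\<^sup>2 / (4 * real j))"
      using binomial_tail_bound[OF assms, of k] by (simp add: sum_divide_distrib)
    finally show ?thesis .
  qed
  ultimately show ?thesis by blast
qed

section \<open>Truncation of the binomial series\<close>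

text \<open>The quotient of the coefficient by (-1)^j j^(-\<alpha>-1) converges to 1 / Gamma
  (-\<alpha>), read as 0 at the poles of Gamma, and a convergent sequence is bounded.\<close>

lemma gbinomial_bound:
  fixes \<alpha> :: real
  obtains C where "C > 0" "\<And>j. j \<ge> 1 \<Longrightarrow> \<bar>\<alpha> gchoose j\<bar> \<le> C * real j powr (- \<alpha> - 1)"
proof -
  have "Bseq (\<lambda>n. (\<alpha> gchoose n) / ((-1) ^ n / exp ((\<alpha> + 1) * ln (real n))))"
    using gbinomial_asymptotic[of \<alpha>] by (intro convergent_imp_Bseq convergentI) simp
  then obtain C where C: "C > 0"
    "\<And>n. \<bar>(\<alpha> gchoose n) / ((-1) ^ n / exp ((\<alpha> + 1) * ln (real n)))\<bar> \<le> C"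
    by (auto simp: Bseq_def)
  have "\<bar>\<alpha> gchoose j\<bar> \<le> C * real j powr (- \<alpha> - 1)" if "j \<ge> 1" for j
  proof -
    define E where "E = exp ((\<alpha> + 1) * ln (real j))"
    have C': "\<bar>(\<alpha> gchoose j) / ((-1) ^ j / E)\<bar> \<le> C"
      using C(2)[of j] by (simp add: E_def)
    have "real j powr (- \<alpha> - 1) = 1 / E"
      using that by (simp add: E_def powr_def exp_minus[symmetric] inverse_eq_divide[symmetric] algebra_simps)
    moreover have "E > 0" by (simp add: E_def)
    moreover have "\<bar>\<alpha> gchoose j\<bar> * E \<le> C"
      using C' \<open>E > 0\<close> by (simp add: abs_mult power_abs)
    ultimately show ?thesis
      by (simp add: pos_le_divide_eq)
  qed
  with C that show ?thesis by blast
qed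

text \<open>Mean value theorem for x^(-\<alpha>) on [j, j + 1], whose derivative is smallest in
  absolute value at the right end. It dominates tails of the sum of j^(-\<alpha>-1) by a telescoping
  series.\<close>

lemma powr_le_diff_powr:
  fixes \<alpha> :: real
  assumes "\<alpha> > 0" "j \<ge> 1"
  shows "\<alpha> * real (Suc j) powr (- \<alpha> - 1) \<le> real j powr - \<alpha> - real (Suc j) powr - \<alpha>"
proof -
  have "\<exists>z. z > real j \<and> z < real (Suc j) \<and>
      real (Suc j) powr - \<alpha> - real j powr - \<alpha> = (real (Suc j) - real j) * (- \<alpha> * z powr (- \<alpha> - 1))"
    using assms by (intro MVT2) (auto intro!: derivative_eq_intros)
  then obtain z where z: "z > real j" "z < real (Suc j)"
    "real j powr - \<alpha> - real (Suc j) powr - \<alpha> = \<alpha> * z powr (- \<alpha> - 1)" by auto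
  have "real (Suc j) powr (- \<alpha> - 1) \<le> z powr (- \<alpha> - 1)"
    using z assms by (intro powr_mono2') auto
  then show ?thesis using z assms by simp
qed



text \<open>For small j the exponential compensates the large factor j^(-\<alpha>-1): the bound exp
  (-y) <= M! / y^M with y = k^2 / (4 j) leaves a nonnegative power of j, largest at j = k^2. As the
  result is uniform in j, summing k^2 such terms costs only a factor k^2.\<close>

lemma powr_minus_power_exp_bound:
  fixes \<alpha> :: real
  assumes "\<alpha> > 0"
  obtains C where "C > 0" "\<And>j k. j \<ge> 1 \<Longrightarrow> k \<ge> 1 \<Longrightarrow> j \<le> k\<^sup>2 \<Longrightarrow>
     real j powr (- \<alpha> - 1) * exp (- (real k)\<^sup>2 / (4 * real j)) \<le> C * real k powr (- 2 * \<alpha> - 2)"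
proof -
  define M where "M = nat \<lceil>\<alpha> + 1\<rceil>"
  have M: "real M \<ge> \<alpha> + 1" unfolding M_def by linarith
  have "real j powr (- \<alpha> - 1) * exp (- (real k)\<^sup>2 / (4 * real j))
      \<le> fact M * 4 ^ M * real k powr (- 2 * \<alpha> - 2)" if "j \<ge> 1" "k \<ge> 1" "j \<le> k\<^sup>2" for j k
  proof -
    define y where "y = (real k)\<^sup>2 / (4 * real j)"
    have y: "y > 0" using that by (simp add: y_def)
    \<comment> \<open>A single term of the exponential series.\<close>
    have "y ^ M / fact M \<le> (\<Sum>n. y ^ n /\<^sub>R fact n)"
      using y sum_le_suminf[of "\<lambda>n. y ^ n /\<^sub>R fact n" "{M}"] sums_summable[OF exp_converges[of y]]
      by (simp add: divide_inverse mult.commute)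
    then have "y ^ M / fact M \<le> exp y"
      by (simp add: exp_def)
    then have "exp (- y) \<le> fact M / y ^ M"
      using y by (simp add: exp_minus field_simps)
    then have "real j powr (- \<alpha> - 1) * exp (- y) \<le> real j powr (- \<alpha> - 1) * (fact M / y ^ M)"
      by (intro mult_left_mono) auto
    also have "\<dots> = fact M * 4 ^ M * (real j powr (- \<alpha> - 1) * real j ^ M) / real k ^ (2 * M)"
      using that by (simp add: y_def power_divide power_mult_distrib power_mult)
    also have "real j powr (- \<alpha> - 1) * real j ^ M = real j powr (real M - \<alpha> - 1)"
      using that by (simp add: algebra_simps flip: powr_realpow powr_add)
    also have "fact M * 4 ^ M * \<dots> / real k ^ (2 * M)
        \<le> fact M * 4 ^ M * ((real k)\<^sup>2) powr (real M - \<alpha> - 1) / real k ^ (2 * M)"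
      using that M
      by (intro divide_right_mono mult_left_mono powr_mono2) (auto simp flip: of_nat_power)
    also have "((real k)\<^sup>2) powr (real M - \<alpha> - 1) = real k powr (2 * (real M - \<alpha> - 1))"
      using that powr_powr[of "real k" 2 "real M - \<alpha> - 1"] by simp
    also have "fact M * 4 ^ M * \<dots> / real k ^ (2 * M) = fact M * 4 ^ M * (\<dots> / real k powr (2 * real M))"
      using that by (simp add: powr_realpow[symmetric])
    also have "real k powr (2 * (real M - \<alpha> - 1)) / real k powr (2 * real M) = real k powr (- 2 * \<alpha> - 2)"
      unfolding powr_diff[symmetric] by (rule arg_cong[where f = "\<lambda>e. real k powr e"]) (simp add: algebra_simps)
    finally show ?thesis by (simp add: y_def)
  qed
  then show ?thesis by (intro that[of "fact M * 4 ^ M"]) auto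
qed



text \<open>Two errors arise, both of order k^(-2 \<alpha>): one from cutting the series of (1 - (1
  - s))^\<alpha> off after degree k^2, one from replacing each power of 1 - s by a polynomial of
  degree at most k.\<close>

theorem powr_approx_polynomial:
  fixes \<alpha> :: real
  assumes "\<alpha> > 0"
  obtains C where "C \<ge> 1"
    "\<And>k. k \<ge> 1 \<Longrightarrow> \<exists>Q :: real poly. degree Q \<le> k \<and>
       (\<forall>s\<in>{0..1}. \<bar>s powr \<alpha> - poly Q s\<bar> \<le> C * real k powr (- 2 * \<alpha>))"
proof -
  obtain C1 where C1: "C1 > 0" "\<And>j. j \<ge> 1 \<Longrightarrow> \<bar>\<alpha> gchoose j\<bar> \<le> C1 * real j powr (- \<alpha> - 1)"
    using gbinomial_bound[of \<alpha>] by blast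
  obtain C2 where C2: "C2 > 0" "\<And>j k. j \<ge> 1 \<Longrightarrow> k \<ge> 1 \<Longrightarrow> j \<le> k\<^sup>2 \<Longrightarrow>
     real j powr (- \<alpha> - 1) * exp (- (real k)\<^sup>2 / (4 * real j)) \<le> C2 * real k powr (- 2 * \<alpha> - 2)"
    using powr_minus_power_exp_bound[OF assms] by blast
  define b where "b j = (-1) ^ j * (\<alpha> gchoose j)" for j
  have b: "\<bar>b j\<bar> \<le> C1 * real j powr (- \<alpha> - 1)" if "j \<ge> 1" for j
    using C1(2)[OF that] by (simp add: b_def abs_mult)
  \<comment> \<open>The summands account for the cut-off, for the replacement of the powers, and for
    C >= 1.\<close>
  define C where "C = C1 / \<alpha> + 2 * C1 * C2 + 1"
  have approx: "\<exists>Q :: real poly. degree Q \<le> k \<and>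
       (\<forall>s\<in>{0..1}. \<bar>s powr \<alpha> - poly Q s\<bar> \<le> C * real k powr (- 2 * \<alpha>))"
    if k: "k \<ge> 1" for k
  proof -
    define N where "N = k\<^sup>2"
    have N: "N \<ge> 1" using k by (simp add: N_def)
    have kN: "real N powr - \<alpha> = real k powr (- 2 * \<alpha>)"
      using k powr_powr[of "real k" 2 "- \<alpha>"] by (simp add: N_def)
    \<comment> \<open>The binomial series is used where |s - 1| < 1; the end s = 0 is reached later
      by a limit.\<close>
    have series: "(\<lambda>j. b j * (1 - s) ^ j) sums (s powr \<alpha>)" if "s > 0" "s \<le> 1" for s
    proof -
      have "(\<alpha> gchoose j) * (s - 1) ^ j = b j * (1 - s) ^ j" for j
      proof -
        have "(s - 1) ^ j = (-1) ^ j * (1 - s) ^ j"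
          by (simp flip: power_mult_distrib)
        then show ?thesis by (simp add: b_def)
      qed
      then show ?thesis
        using gen_binomial_real[of "s - 1" \<alpha>] that by (simp add: abs_if)
    qed
    let ?tail = "\<lambda>i. real (N + i) powr - \<alpha> - real (Suc (N + i)) powr - \<alpha>"
    have tail_sums: "?tail sums (real N powr - \<alpha>)"
    proof -
      have "(\<lambda>i. real (N + i) powr - \<alpha>) \<longlonglongrightarrow> 0"
        using LIMSEQ_ignore_initial_segment[OF tendsto_neg_powr[of "- \<alpha>", OF _ filterlim_real_sequentially], of N] assms
        by (simp add: add.commute)
      from telescope_sums'[OF this] show ?thesis by simp
    qed
    have trunc_pos: "\<bar>s powr \<alpha> - (\<Sum>j\<le>N. b j * (1 - s) ^ j)\<bar> \<le> C1 / \<alpha> * real k powr (- 2 * \<alpha>)"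
      if s: "s > 0" "s \<le> 1" for s
    proof -
      \<comment> \<open>The index i + Suc N is the right end of the unit interval starting at N + i,
        so each term is dominated by a telescoping difference.\<close>
      have bnd: "\<bar>b (i + Suc N) * (1 - s) ^ (i + Suc N)\<bar> \<le> C1 / \<alpha> * ?tail i" for i
      proof -
        have "\<bar>b (i + Suc N) * (1 - s) ^ (i + Suc N)\<bar> \<le> \<bar>b (i + Suc N)\<bar>"
          using s power_le_one[of "1 - s" "i + Suc N"]
          by (simp add: abs_mult power_abs mult_left_le del: power_Suc add_Suc_right)
        also have "\<dots> \<le> C1 * real (Suc (N + i)) powr (- \<alpha> - 1)"
          using b[of "i + Suc N"] by (simp add: add_ac)
        also have "\<dots> \<le> C1 * (?tail i / \<alpha>)"
          using powr_le_diff_powr[OF assms, of "N + i"] N assms C1(1)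
          by (intro mult_left_mono) (auto simp: field_simps)
        finally show ?thesis by simp
      qed
      have tl: "(\<lambda>i. C1 / \<alpha> * ?tail i) sums (C1 / \<alpha> * real k powr (- 2 * \<alpha>))"
        unfolding kN[symmetric] by (rule sums_mult[OF tail_sums])
      have "(\<lambda>i. b (i + Suc N) * (1 - s) ^ (i + Suc N)) sums
          (s powr \<alpha> - (\<Sum>j<Suc N. b j * (1 - s) ^ j))"
        by (rule sums_split_initial_segment[OF series[OF s]])
      then have "s powr \<alpha> - (\<Sum>j\<le>N. b j * (1 - s) ^ j) =
          (\<Sum>i. b (i + Suc N) * (1 - s) ^ (i + Suc N))"
        by (simp add: sums_iff lessThan_Suc_atMost)
      also have "\<bar>\<dots>\<bar> \<le> (\<Sum>i. C1 / \<alpha> * ?tail i)"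
        using norm_suminf_le[of "\<lambda>i. b (i + Suc N) * (1 - s) ^ (i + Suc N)" "\<lambda>i. C1 / \<alpha> * ?tail i"]
          bnd sums_summable[OF tl] by simp
      also have "\<dots> = C1 / \<alpha> * real k powr (- 2 * \<alpha>)"
        using tl by (simp add: sums_iff)
      finally show ?thesis .
    qed
    have trunc: "\<bar>s powr \<alpha> - (\<Sum>j\<le>N. b j * (1 - s) ^ j)\<bar> \<le> C1 / \<alpha> * real k powr (- 2 * \<alpha>)"
      if s: "s \<in> {0..1}" for s
    proof (cases "s = 0")
      case True
      \<comment> \<open>The cut-off error is continuous from the right at 0 because \<alpha> > 0, so
        the bound for s > 0 passes to the limit.\<close>
      have "((\<lambda>s. \<bar>s powr \<alpha> - (\<Sum>j\<le>N. b j * (1 - s) ^ j)\<bar>) \<longlongrightarrow>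
          \<bar>0 powr \<alpha> - (\<Sum>j\<le>N. b j * (1 - 0) ^ j)\<bar>) (at_right 0)"
        using assms by (intro tendsto_intros tendsto_powr') (auto simp: eventually_at_right_field intro: exI[of _ 1])
      moreover have "eventually (\<lambda>s. \<bar>s powr \<alpha> - (\<Sum>j\<le>N. b j * (1 - s) ^ j)\<bar>
          \<le> C1 / \<alpha> * real k powr (- 2 * \<alpha>)) (at_right 0)"
        using trunc_pos by (auto simp: eventually_at_right_field intro!: exI[of _ 1])
      ultimately show ?thesis
        using True by (auto intro: tendsto_upperbound)
    qed (use trunc_pos s in auto)
    obtain P :: "nat \<Rightarrow> real poly" where P: "\<And>j. j \<ge> 1 \<Longrightarrow> degree (P j) \<le> k"
      "\<And>j x. j \<ge> 1 \<Longrightarrow> x \<in> {-1..1} \<Longrightarrow>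
         \<bar>x ^ j - poly (P j) x\<bar> \<le> 2 * exp (- (real k)\<^sup>2 / (4 * real j))"
      using power_approx_low_degree[of _ k] by metis
    \<comment> \<open>The term j = 0 is kept exactly, since the low-degree approximations are for j
      >= 1. \<open>Q\<close> then substitutes 1 - s for the variable.\<close>
    define R where "R = [:b 0:] + (\<Sum>j=1..N. smult (b j) (P j))"
    define Q where "Q = pcompose R [:1, -1:]"
    have "degree R \<le> k"
      unfolding R_def using P
      by (intro degree_add_le degree_sum_le) (auto intro: order.trans[OF degree_smult_le])
    then have "degree Q \<le> k"
      using degree_pcompose_le[of R "[:1, -1:]"] by (simp add: Q_def)
    moreover have "\<bar>s powr \<alpha> - poly Q s\<bar> \<le> C * real k powr (- 2 * \<alpha>)" if s: "s \<in> {0..1}" for s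
    proof -
      have split: "(\<Sum>j\<le>N. b j * (1 - s) ^ j) = b 0 + (\<Sum>j=1..N. b j * (1 - s) ^ j)"
        by (simp add: atMost_atLeast0 sum.atLeast_Suc_atMost)
      have "poly Q s = b 0 + (\<Sum>j=1..N. b j * poly (P j) (1 - s))"
        by (simp add: Q_def R_def poly_pcompose poly_sum)
      then have "\<bar>(\<Sum>j\<le>N. b j * (1 - s) ^ j) - poly Q s\<bar> =
          \<bar>\<Sum>j=1..N. b j * ((1 - s) ^ j - poly (P j) (1 - s))\<bar>"
        unfolding split by (simp add: right_diff_distrib sum_subtractf)
      also have "\<dots> \<le> (\<Sum>j=1..N. \<bar>b j * ((1 - s) ^ j - poly (P j) (1 - s))\<bar>)"
        by (rule sum_abs)
      also have "\<dots> \<le> (\<Sum>j=1..N. 2 * C1 * C2 * real k powr (- 2 * \<alpha> - 2))"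
      proof (intro sum_mono)
        fix j assume j: "j \<in> {1..N}"
        have "\<bar>b j * ((1 - s) ^ j - poly (P j) (1 - s))\<bar> \<le>
            (C1 * real j powr (- \<alpha> - 1)) * (2 * exp (- (real k)\<^sup>2 / (4 * real j)))"
          unfolding abs_mult using j s C1(1) by (intro mult_mono b P) auto
        also have "\<dots> = 2 * C1 * (real j powr (- \<alpha> - 1) * exp (- (real k)\<^sup>2 / (4 * real j)))"
          by simp
        also have "\<dots> \<le> 2 * C1 * (C2 * real k powr (- 2 * \<alpha> - 2))"
          using C1(1) j k by (intro mult_left_mono C2) (auto simp: N_def)
        finally show "\<bar>b j * ((1 - s) ^ j - poly (P j) (1 - s))\<bar> \<le>
            2 * C1 * C2 * real k powr (- 2 * \<alpha> - 2)" by simp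
      qed
      also have "\<dots> = 2 * C1 * C2 * (real N * real k powr (- 2 * \<alpha> - 2))"
        by simp
      \<comment> \<open>The number N = k^2 of terms cancels the extra factor k^(-2).\<close>
      also have "real N * real k powr (- 2 * \<alpha> - 2) = real k powr (- 2 * \<alpha>)"
        using k by (simp add: N_def powr_diff)
      finally have "\<bar>(\<Sum>j\<le>N. b j * (1 - s) ^ j) - poly Q s\<bar> \<le> 2 * C1 * C2 * real k powr (- 2 * \<alpha>)" .
      moreover have "0 \<le> real k powr (- 2 * \<alpha>)" by simp
      ultimately show ?thesis
        using trunc[OF s] unfolding C_def distrib_right by linarith
    qed
    ultimately show ?thesis by blast
  qed
  have "C \<ge> 1" using C1 C2 assms by (simp add: C_def)
  with approx that show ?thesis by blast
qed

subsection \<open>Rank of a perturbed identity matrix\<close>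

text \<open>Linear span with one coefficient per element of \<open>G\<close>, so that
  \<open>card G\<close> bounds the dimension. It is meant for finite \<open>G\<close>: a sum over an
  infinite set is 0.\<close>

definition fun_span :: "('x \<Rightarrow> real) set \<Rightarrow> ('x \<Rightarrow> real) set" where
  "fun_span G = {f. \<exists>c. f = (\<lambda>x. \<Sum>g\<in>G. c g * g x)}"

lemma fun_span_add:
  assumes "f \<in> fun_span G" "h \<in> fun_span G"
  shows "(\<lambda>x. f x + h x) \<in> fun_span G"
proof -
  from assms obtain c c' where "f = (\<lambda>x. \<Sum>g\<in>G. c g * g x)" "h = (\<lambda>x. \<Sum>g\<in>G. c' g * g x)"
    unfolding fun_span_def by blast
  then show ?thesis
    unfolding fun_span_def
    by (intro CollectI exI[of _ "\<lambda>g. c g + c' g"]) (simp add: sum.distrib distrib_right)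
qed

lemma fun_span_scale:
  assumes "f \<in> fun_span G"
  shows "(\<lambda>x. u * f x) \<in> fun_span G"
proof -
  from assms obtain c where "f = (\<lambda>x. \<Sum>g\<in>G. c g * g x)"
    unfolding fun_span_def by blast
  then show ?thesis
    unfolding fun_span_def
    by (intro CollectI exI[of _ "\<lambda>g. u * c g"]) (simp add: sum_distrib_left mult.assoc)
qed

lemma fun_span_zero: "(\<lambda>x. 0) \<in> fun_span G"
  unfolding fun_span_def by (intro CollectI exI[of _ "\<lambda>_. 0"]) simp

lemma fun_span_base:
  assumes "finite G" "g \<in> G"
  shows "g \<in> fun_span G"
  unfolding fun_span_def using assms
  by (intro CollectI exI[of _ "\<lambda>h. if h = g then 1 else 0"])
     (simp add: if_distrib [of "\<lambda>c. c * _"] cong: if_cong)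

lemma fun_span_sum:
  assumes "\<And>i. i \<in> I \<Longrightarrow> f i \<in> fun_span G"
  shows "(\<lambda>x. \<Sum>i\<in>I. f i x) \<in> fun_span G"
  using assms
  by (induction I rule: infinite_finite_induct) (simp_all add: fun_span_zero fun_span_add)

text \<open>Multiplication by \<open>h\<close> is linear, so it suffices to look at the
  generators.\<close>

lemma fun_span_mult:
  assumes "f \<in> fun_span G" "\<And>g. g \<in> G \<Longrightarrow> (\<lambda>x. h x * g x) \<in> fun_span G'"
  shows "(\<lambda>x. h x * f x) \<in> fun_span G'"
proof -
  from assms(1) obtain c where c: "f = (\<lambda>x. \<Sum>g\<in>G. c g * g x)"
    unfolding fun_span_def by blast
  have "(\<lambda>x. \<Sum>g\<in>G. c g * (h x * g x)) \<in> fun_span G'"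
    by (intro fun_span_sum fun_span_scale assms(2))
  then show ?thesis by (simp add: c sum_distrib_left mult.left_commute)
qed

lemma fun_span_mono:
  assumes "f \<in> fun_span G" "G \<subseteq> G'" "finite G'"
  shows "f \<in> fun_span G'"
  using fun_span_mult[of f G "\<lambda>_. 1" G'] assms by (auto intro: fun_span_base)

text \<open>Precomposition is linear. This carries functions of one block of coordinates over to
  functions of the whole point.\<close>

lemma fun_span_comp:
  assumes "f \<in> fun_span G" "finite G'" "\<And>g. g \<in> G \<Longrightarrow> (\<lambda>x. g (\<phi> x)) \<in> G'"
  shows "(\<lambda>x. f (\<phi> x)) \<in> fun_span G'"
proof -
  from assms(1) obtain c where c: "f = (\<lambda>x. \<Sum>g\<in>G. c g * g x)"
    unfolding fun_span_def by blast
  have "(\<lambda>x. \<Sum>g\<in>G. c g * g (\<phi> x)) \<in> fun_span G'"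
    by (intro fun_span_sum fun_span_scale fun_span_base assms)
  then show ?thesis by (simp add: c)
qed

text \<open>Gram--Schmidt without discarding dependent functions: those become null functions, hence the
  norms in \<open>{0, 1}\<close>.\<close>

lemma gram_schmidt:
  fixes G :: "('x \<Rightarrow> real) set"
  assumes "finite G" "finite S"
  shows "\<exists>e :: nat \<Rightarrow> 'x \<Rightarrow> real.
    (\<forall>r<card G. \<forall>s<card G. r \<noteq> s \<longrightarrow> (\<Sum>x\<in>S. e r x * e s x) = 0) \<and>
    (\<forall>r<card G. (\<Sum>x\<in>S. e r x * e r x) \<in> {0, 1}) \<and>
    (\<forall>g\<in>G. \<exists>u. \<forall>x\<in>S. g x = (\<Sum>r<card G. u r * e r x))"
  using assms(1)
proof (induction G rule: finite_induct)
  case empty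
  then show ?case by simp
next
  case (insert h G)
  define R where "R = card G"
  let ?ip = "\<lambda>f g. \<Sum>x\<in>S. f x * g x"
  obtain e :: "nat \<Rightarrow> 'x \<Rightarrow> real" where
    "(\<forall>r<R. \<forall>s<R. r \<noteq> s \<longrightarrow> ?ip (e r) (e s) = 0) \<and> (\<forall>r<R. ?ip (e r) (e r) \<in> {0, 1}) \<and>
     (\<forall>g\<in>G. \<exists>u. \<forall>x\<in>S. g x = (\<Sum>r<R. u r * e r x))"
    using insert.IH[folded R_def] by (elim exE)
  then have orth: "\<And>r s. r < R \<Longrightarrow> s < R \<Longrightarrow> r \<noteq> s \<Longrightarrow> ?ip (e r) (e s) = 0"
    and norm: "\<And>r. r < R \<Longrightarrow> ?ip (e r) (e r) \<in> {0, 1}"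
    and span: "\<And>g. g \<in> G \<Longrightarrow> \<exists>u. \<forall>x\<in>S. g x = (\<Sum>r<R. u r * e r x)"
    by simp_all
  define w where "w x = h x - (\<Sum>r<R. ?ip h (e r) * e r x)" for x
  \<comment> \<open>If \<open>w\<close> vanishes on \<open>S\<close>, the divisor is 0 and division
    by 0 makes the new function zero everywhere; this is where norm 0 comes from.\<close>
  define e' where "e' = e(R := (\<lambda>x. w x / sqrt (?ip w w)))"
  have e'_less: "e' r = e r" if "r < R" for r
    using that by (simp add: e'_def)
  have w_orth: "?ip w (e s) = 0" if "s < R" for s
  proof -
    have "?ip w (e s) = ?ip h (e s) - (\<Sum>x\<in>S. \<Sum>r<R. ?ip h (e r) * (e r x * e s x))"
      by (simp add: w_def left_diff_distrib sum_subtractf sum_distrib_right mult.assoc)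
    also have "(\<Sum>x\<in>S. \<Sum>r<R. ?ip h (e r) * (e r x * e s x)) =
        (\<Sum>r<R. ?ip h (e r) * ?ip (e r) (e s))"
      by (subst sum.swap) (simp add: sum_distrib_left)
    also have "\<dots> = (\<Sum>r<R. if r = s then ?ip h (e s) * ?ip (e s) (e s) else 0)"
      by (intro sum.cong refl) (use orth that in auto)
    also have "\<dots> = ?ip h (e s) * ?ip (e s) (e s)"
      using that by simp
    finally have eq: "?ip w (e s) = ?ip h (e s) - ?ip h (e s) * ?ip (e s) (e s)" .
    \<comment> \<open>A function of norm 0 vanishes on \<open>S\<close>; otherwise the norm is 1 and
      the two terms in \<open>eq\<close> cancel.\<close>
    show ?thesis
    proof (cases "?ip (e s) (e s) = 0")
      case True
      then have "\<forall>x\<in>S. e s x = 0"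
        using assms(2) by (subst (asm) sum_nonneg_eq_0_iff) auto
      then show ?thesis by simp
    next
      case False
      then show ?thesis using eq norm[OF that] by auto
    qed
  qed
  have w_eq: "w x = sqrt (?ip w w) * e' R x" if "x \<in> S" for x
  proof (cases "?ip w w = 0")
    case True
    then have "\<forall>x\<in>S. w x = 0"
      using assms(2) by (subst (asm) sum_nonneg_eq_0_iff) auto
    then show ?thesis using that by simp
  qed (simp add: e'_def)
  have "?ip (e' r) (e' s) = 0" if "r < Suc R" "s < Suc R" "r \<noteq> s" for r s
  proof -
    have new: "?ip (e' R) (e s) = 0" if "s < R" for s
      using w_orth[OF that] by (simp add: e'_def sum_divide_distrib[symmetric])
    then have new': "?ip (e s) (e' R) = 0" if "s < R" for s
      using that by (simp add: mult.commute)
    show ?thesis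
      using that new new' orth e'_less by (cases "r = R"; cases "s = R") auto
  qed
  moreover have "?ip (e' r) (e' r) \<in> {0, 1}" if "r < Suc R" for r
  proof (cases "r = R")
    case True
    have "?ip w w \<ge> 0" by (intro sum_nonneg) auto
    then show ?thesis
      using True by (simp add: e'_def sum_divide_distrib[symmetric])
  qed (use that norm e'_less in auto)
  moreover have "\<exists>u. \<forall>x\<in>S. g x = (\<Sum>r<Suc R. u r * e' r x)" if g: "g \<in> insert h G" for g
  proof (cases "g = h")
    case True
    have "g x = (\<Sum>r<Suc R. ((\<lambda>r. ?ip h (e r))(R := sqrt (?ip w w))) r * e' r x)" if "x \<in> S" for x
    proof -
      have "g x = (\<Sum>r<R. ?ip h (e r) * e r x) + w x"
        by (simp add: True w_def)
      also have "\<dots> = (\<Sum>r<R. ?ip h (e r) * e r x) + sqrt (?ip w w) * e' R x"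
        using w_eq[OF that] by simp
      finally show ?thesis by (simp add: e'_less)
    qed
    then show ?thesis
      by (intro exI[of _ "(\<lambda>r. ?ip h (e r))(R := sqrt (?ip w w))"] ballI)
  next
    case False
    then obtain u where u: "\<forall>x\<in>S. g x = (\<Sum>r<R. u r * e r x)"
      using span[of g] g by auto
    have "\<forall>x\<in>S. g x = (\<Sum>r<Suc R. (u(R := 0)) r * e' r x)"
      using u by (simp add: e'_less)
    then show ?thesis by (intro exI[of _ "u(R := 0)"])
  qed
  moreover have "card (insert h G) = Suc R"
    using insert.hyps by (simp add: R_def)
  ultimately show ?case
    by (intro exI[of _ e'] conjI allI impI ballI) (simp_all only:)
qed

text \<open>For the orthogonal projection $P$ to the column space, $\mathrm{tr} B = \langle P, B \rangle$
  by $PB = B$, and the Hilbert--Schmidt norm of $P$ is the root of the rank.\<close>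

lemma trace_square_le:
  fixes B :: "'x \<Rightarrow> 'x \<Rightarrow> real"
  assumes "finite G" "finite S" "\<And>y. y \<in> S \<Longrightarrow> (\<lambda>x. B x y) \<in> fun_span G"
  shows "(\<Sum>x\<in>S. B x x)\<^sup>2 \<le> real (card G) * (\<Sum>y\<in>S. \<Sum>x\<in>S. (B x y)\<^sup>2)"
proof -
  define R where "R = card G"
  let ?ip = "\<lambda>f g. \<Sum>x\<in>S. f x * g x"
  obtain e :: "nat \<Rightarrow> 'x \<Rightarrow> real" where
    "(\<forall>r<R. \<forall>s<R. r \<noteq> s \<longrightarrow> ?ip (e r) (e s) = 0) \<and> (\<forall>r<R. ?ip (e r) (e r) \<in> {0, 1}) \<and>
     (\<forall>g\<in>G. \<exists>u. \<forall>x\<in>S. g x = (\<Sum>r<R. u r * e r x))"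
    using gram_schmidt[OF assms(1,2), folded R_def] by (elim exE)
  then have orth: "\<And>r s. r < R \<Longrightarrow> s < R \<Longrightarrow> r \<noteq> s \<Longrightarrow> ?ip (e r) (e s) = 0"
    and norm: "\<And>r. r < R \<Longrightarrow> ?ip (e r) (e r) \<in> {0, 1}"
    and span: "\<And>g. g \<in> G \<Longrightarrow> \<exists>u. \<forall>x\<in>S. g x = (\<Sum>r<R. u r * e r x)"
    by simp_all
  have "\<exists>u. \<forall>x\<in>S. B x y = (\<Sum>r<R. u r * e r x)" if y: "y \<in> S" for y
  proof -
    obtain c where c: "(\<lambda>x. B x y) = (\<lambda>x. \<Sum>g\<in>G. c g * g x)"
      using assms(3)[OF y] unfolding fun_span_def by blast
    obtain v where v: "\<And>g x. g \<in> G \<Longrightarrow> x \<in> S \<Longrightarrow> g x = (\<Sum>r<R. v g r * e r x)"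
      using span by metis
    have "B x y = (\<Sum>r<R. (\<Sum>g\<in>G. c g * v g r) * e r x)" if "x \<in> S" for x
    proof -
      have "B x y = (\<Sum>g\<in>G. c g * g x)"
        using c by (rule fun_cong)
      also have "\<dots> = (\<Sum>g\<in>G. c g * (\<Sum>r<R. v g r * e r x))"
        by (intro sum.cong refl arg_cong2[where f = "(*)"] v that)
      also have "\<dots> = (\<Sum>g\<in>G. \<Sum>r<R. c g * v g r * e r x)"
        by (simp add: sum_distrib_left mult.assoc)
      also have "\<dots> = (\<Sum>r<R. (\<Sum>g\<in>G. c g * v g r) * e r x)"
        by (subst sum.swap) (simp add: sum_distrib_right)
      finally show ?thesis .
    qed
    then show ?thesis by (intro exI[of _ "\<lambda>r. \<Sum>g\<in>G. c g * v g r"]) simp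
  qed
  then obtain u where u: "\<And>x y. x \<in> S \<Longrightarrow> y \<in> S \<Longrightarrow> B x y = (\<Sum>r<R. u y r * e r x)"
    by metis
  define N where "N r = ?ip (e r) (e r)" for r
  have N: "N r * N r = N r" "N r \<le> 1" if "r < R" for r
    using norm[OF that] by (auto simp: N_def)
  \<comment> \<open>A null function vanishes on \<open>S\<close>, so the factor \<open>N r\<close>
    changes nothing there. Inserting it removes the arbitrary coefficients of null
    functions.\<close>
  have eN: "e r x = N r * e r x" if "r < R" "x \<in> S" for r x
  proof (cases "N r = 0")
    case True
    then show ?thesis
      unfolding N_def using that assms(2) by (subst (asm) sum_nonneg_eq_0_iff) auto
  qed (use norm[OF that(1)] in \<open>auto simp: N_def\<close>)
  \<comment> \<open>Parseval's identity for a column of \<open>B\<close>.\<close>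
  have column: "(\<Sum>x\<in>S. (B x y)\<^sup>2) = (\<Sum>r<R. (u y r * N r)\<^sup>2)" if "y \<in> S" for y
  proof -
    have "(\<Sum>x\<in>S. (B x y)\<^sup>2) = (\<Sum>x\<in>S. \<Sum>r<R. \<Sum>s<R. u y r * u y s * (e r x * e s x))"
      using u that by (intro sum.cong refl) (simp add: power2_eq_square sum_product mult_ac)
    also have "\<dots> = (\<Sum>r<R. \<Sum>s<R. \<Sum>x\<in>S. u y r * u y s * (e r x * e s x))"
      by (subst sum.swap) (intro sum.cong refl sum.swap)
    also have "\<dots> = (\<Sum>r<R. \<Sum>s<R. if s = r then u y r * u y r * N r else 0)"
      by (intro sum.cong refl) (auto simp: sum_distrib_left[symmetric] orth N_def)
    also have "\<dots> = (\<Sum>r<R. (u y r)\<^sup>2 * (N r * N r))"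
      by (intro sum.cong refl) (simp add: power2_eq_square N(1))
    also have "\<dots> = (\<Sum>r<R. (u y r * N r)\<^sup>2)"
      by (simp add: power2_eq_square mult_ac)
    finally show ?thesis .
  qed
  have "(\<Sum>x\<in>S. B x x) = (\<Sum>x\<in>S. \<Sum>r<R. (u x r * N r) * e r x)"
  proof (intro sum.cong refl)
    fix x assume x: "x \<in> S"
    have "B x x = (\<Sum>r<R. u x r * e r x)" using u x by blast
    also have "\<dots> = (\<Sum>r<R. (u x r * N r) * e r x)"
      by (intro sum.cong refl) (metis eN x lessThan_iff mult.assoc)
    finally show "B x x = \<dots>" .
  qed
  also have "\<dots> = (\<Sum>q\<in>S \<times> {..<R}. (u (fst q) (snd q) * N (snd q)) * e (snd q) (fst q))"
    unfolding sum.cartesian_product by (intro sum.cong) auto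
  finally have "(\<Sum>x\<in>S. B x x)\<^sup>2 = \<dots>\<^sup>2" by (rule arg_cong)
  \<comment> \<open>Cauchy-Schwarz over pairs of a point and an index. The first factor is the sum
    of the squared entries of \<open>B\<close>, the second the sum of the squared norms of the
    \<open>e r\<close>, hence at most R.\<close>
  also have "\<dots> \<le> (\<Sum>q\<in>S \<times> {..<R}. (u (fst q) (snd q) * N (snd q))\<^sup>2) *
      (\<Sum>q\<in>S \<times> {..<R}. (e (snd q) (fst q))\<^sup>2)"
    by (rule Cauchy_Schwarz_ineq_sum)
  also have "(\<Sum>q\<in>S \<times> {..<R}. (u (fst q) (snd q) * N (snd q))\<^sup>2) = (\<Sum>y\<in>S. \<Sum>r<R. (u y r * N r)\<^sup>2)"
    unfolding sum.cartesian_product by (intro sum.cong) auto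
  also have "\<dots> = (\<Sum>y\<in>S. \<Sum>x\<in>S. (B x y)\<^sup>2)"
    by (simp add: column)
  also have "(\<Sum>q\<in>S \<times> {..<R}. (e (snd q) (fst q))\<^sup>2) = (\<Sum>x\<in>S. \<Sum>r<R. (e r x)\<^sup>2)"
    unfolding sum.cartesian_product by (intro sum.cong) auto
  also have "\<dots> = (\<Sum>r<R. N r)"
    by (subst sum.swap) (simp add: N_def power2_eq_square)
  also have "(\<Sum>y\<in>S. \<Sum>x\<in>S. (B x y)\<^sup>2) * (\<Sum>r<R. N r) \<le> (\<Sum>y\<in>S. \<Sum>x\<in>S. (B x y)\<^sup>2) * real R"
  proof (intro mult_left_mono)
    show "(\<Sum>r<R. N r) \<le> real R"
      using sum_mono[of "{..<R}" N "\<lambda>_. 1"] N by simp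
  qed (intro sum_nonneg; simp)
  finally show ?thesis by (simp add: R_def mult.commute)
qed

subsection \<open>Polynomials in the squared distance\<close>

text \<open>Bounding each exponent separately instead of the total degree makes the index set a
  product, which gives the count (D + 1)^a. \<open>PiE\<close> fixes the exponents outside
  \<open>{..<a}\<close> and so keeps that set finite.\<close>

definition grid_monomials :: "nat \<Rightarrow> nat \<Rightarrow> ((nat \<Rightarrow> real) \<Rightarrow> real) set" where
  "grid_monomials a D = (\<lambda>e z. \<Prod>t<a. z t ^ e t) ` PiE {..<a} (\<lambda>_. {..D})"

lemma finite_grid_monomials: "finite (grid_monomials a D)"
  unfolding grid_monomials_def by (intro finite_imageI finite_PiE) auto

lemma card_grid_monomials_le: "card (grid_monomials a D) \<le> Suc D ^ a"
proof -
  have "card (grid_monomials a D) \<le> card (PiE {..<a} (\<lambda>_. {..D}))"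
    unfolding grid_monomials_def by (intro card_image_le finite_PiE) auto
  then show ?thesis by (simp add: card_PiE)
qed

lemma grid_monomials_mono:
  assumes "D \<le> E"
  shows "grid_monomials a D \<subseteq> grid_monomials a E"
  unfolding grid_monomials_def using assms by (intro image_mono PiE_mono) auto

lemma one_in_grid_monomials: "(\<lambda>z. 1) \<in> grid_monomials a D"
  unfolding grid_monomials_def
  by (rule image_eqI[of _ _ "\<lambda>t\<in>{..<a}. 0"]) auto

lemma coordinate_times_grid_monomial:
  assumes "g \<in> grid_monomials a D" "t < a"
  shows "(\<lambda>z. z t * g z) \<in> grid_monomials a (Suc D)"
proof -
  obtain e where e: "e \<in> PiE {..<a} (\<lambda>_. {..D})" "g = (\<lambda>z. \<Prod>s<a. z s ^ e s)"
    using assms(1) unfolding grid_monomials_def by blast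
  have "(\<lambda>z. z t * g z) = (\<lambda>z. \<Prod>s<a. z s ^ (e(t := Suc (e t))) s)"
  proof
    fix z :: "nat \<Rightarrow> real"
    have "(\<Prod>s<a. z s ^ (e(t := Suc (e t))) s) =
        z t ^ Suc (e t) * (\<Prod>s\<in>{..<a} - {t}. z s ^ (e(t := Suc (e t))) s)"
      using assms(2) by (subst prod.remove[of _ t]) auto
    also have "(\<Prod>s\<in>{..<a} - {t}. z s ^ (e(t := Suc (e t))) s) = (\<Prod>s\<in>{..<a} - {t}. z s ^ e s)"
      by (intro prod.cong) auto
    also have "z t ^ Suc (e t) * \<dots> = z t * g z"
      using assms(2) by (simp add: e prod.remove[of "{..<a}" t])
    finally show "z t * g z = (\<Prod>s<a. z s ^ (e(t := Suc (e t))) s)" by simp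
  qed
  moreover have "e(t := Suc (e t)) \<in> PiE {..<a} (\<lambda>_. {..Suc D})"
    using e(1) assms(2) by (auto simp: PiE_iff extensional_def intro: le_SucI)
  ultimately show ?thesis
    unfolding grid_monomials_def by blast
qed

lemma fun_span_grid_mono:
  assumes "f \<in> fun_span (grid_monomials a D)" "D \<le> E"
  shows "f \<in> fun_span (grid_monomials a E)"
  using assms grid_monomials_mono by (blast intro: fun_span_mono finite_grid_monomials)

lemma fun_span_grid_coordinate:
  assumes "f \<in> fun_span (grid_monomials a D)" "t < a"
  shows "(\<lambda>z. z t * f z) \<in> fun_span (grid_monomials a (Suc D))"
  using assms(1)
  by (rule fun_span_mult)
     (blast intro: fun_span_base finite_grid_monomials coordinate_times_grid_monomial assms(2))

text \<open>Expand each square: \<open>y\<close> enters only through coefficients, and no exponent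
  grows by more than 2. The bound \<open>d \<le> a\<close> lets summands of different dimensions
  share the same monomials.\<close>

lemma fun_span_grid_square_distance:
  assumes f: "f \<in> fun_span (grid_monomials a D)" and "d \<le> a"
  shows "(\<lambda>z. (\<Sum>t<d. (z t - y t)\<^sup>2) * f z) \<in> fun_span (grid_monomials a (D + 2))"
proof -
  have "(\<lambda>z. \<Sum>t<d. z t * (z t * f z) + ((- 2 * y t) * (z t * f z) + (y t)\<^sup>2 * f z))
      \<in> fun_span (grid_monomials a (D + 2))"
  proof (intro fun_span_sum fun_span_add)
    fix t assume "t \<in> {..<d}"
    then have t: "t < a" using assms(2) by simp
    have 1: "(\<lambda>z. z t * f z) \<in> fun_span (grid_monomials a (Suc D))"
      by (rule fun_span_grid_coordinate[OF f t])
    show "(\<lambda>z. z t * (z t * f z)) \<in> fun_span (grid_monomials a (D + 2))"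
      using fun_span_grid_coordinate[OF 1 t] by simp
    show "(\<lambda>z. (- 2 * y t) * (z t * f z)) \<in> fun_span (grid_monomials a (D + 2))"
      by (intro fun_span_scale fun_span_grid_mono[OF 1]) simp
    show "(\<lambda>z. (y t)\<^sup>2 * f z) \<in> fun_span (grid_monomials a (D + 2))"
      by (intro fun_span_scale fun_span_grid_mono[OF f]) simp
  qed
  moreover have "(\<Sum>t<d. (z t - y t)\<^sup>2) * f z =
      (\<Sum>t<d. z t * (z t * f z) + ((- 2 * y t) * (z t * f z) + (y t)\<^sup>2 * f z))" for z
    unfolding sum_distrib_right by (intro sum.cong refl) (simp add: power2_eq_square algebra_simps)
  ultimately show ?thesis by simp
qed

text \<open>Each factor of the squared distance costs degree 2 in every variable, hence 2 k. The
  monomials are the same for all \<open>y\<close>, which is what will bound the rank of a matrix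
  whose columns are indexed by \<open>y\<close>.\<close>

lemma fun_span_grid_poly_square_distance:
  assumes "d \<le> a" "degree Q \<le> k"
  shows "(\<lambda>z. poly Q (c * (\<Sum>t<d. (z t - y t)\<^sup>2))) \<in> fun_span (grid_monomials a (2 * k))"
proof -
  have pow: "(\<lambda>z. (\<Sum>t<d. (z t - y t)\<^sup>2) ^ i) \<in> fun_span (grid_monomials a (2 * i))" for i
  proof (induction i)
    case 0
    then show ?case
      by (simp add: fun_span_base finite_grid_monomials one_in_grid_monomials)
  next
    case (Suc i)
    show ?case
      using fun_span_grid_square_distance[OF Suc assms(1), of y] by simp
  qed
  have "(\<lambda>z. \<Sum>i\<le>degree Q. (coeff Q i * c ^ i) * (\<Sum>t<d. (z t - y t)\<^sup>2) ^ i)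
      \<in> fun_span (grid_monomials a (2 * k))"
    by (intro fun_span_sum fun_span_scale fun_span_grid_mono[OF pow]) (use assms(2) in auto)
  then show ?thesis
    by (simp add: poly_altdef power_mult_distrib mult.assoc)
qed

subsection \<open>Equilateral sets\<close>

lemma euclidean_norm_powr: "euclidean_norm d z powr p = (\<Sum>t<d. (z t)\<^sup>2) powr (p / 2)"
proof -
  have "euclidean_norm d z = (\<Sum>t<d. (z t)\<^sup>2) powr (1 / 2)"
    unfolding euclidean_norm_def L2_set_def by (rule powr_half_sqrt[symmetric]) (simp add: sum_nonneg)
  then show ?thesis by (simp only: powr_powr) simp
qed

text \<open>Taking the p-th power removes the outer root and leaves powers p/2 of squared block
  distances, which are themselves polynomial in the coordinates.\<close>

lemma psum_dist_powr:
  assumes "p > 0"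
  shows "psum_dist p n d x y powr p = (\<Sum>l<n. (\<Sum>t<d l. (x l t - y l t)\<^sup>2) powr (p / 2))"
  using assms
  by (simp add: psum_dist_def psum_norm_def powr_powr euclidean_norm_powr sum_nonneg)

text \<open>By the support conditions of the carrier, a coordinate in which the points differ lies
  in the range that the norm sees.\<close>

lemma psum_dist_pos:
  assumes "x \<in> psum_carrier n d" "y \<in> psum_carrier n d" "x \<noteq> y" "p > 0"
  shows "psum_dist p n d x y > 0"
proof -
  obtain l t where lt: "x l t \<noteq> y l t" using assms(3) by (metis ext)
  have l: "l < n"
    using lt assms(1,2) by (metis (mono_tags, lifting) leI mem_Collect_eq psum_carrier_def)
  have t: "t < d l"
  proof (rule ccontr)
    assume "\<not> t < d l"
    then have "x l t = 0" "y l t = 0"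
      using assms(1,2) l by (auto simp: psum_carrier_def euclidean_carrier_def)
    then show False using lt by simp
  qed
  have "(\<Sum>t<d l. (x l t - y l t)\<^sup>2) > 0"
    using lt t by (intro sum_pos2[of _ t]) auto
  then have "(\<Sum>l<n. (\<Sum>t<d l. (x l t - y l t)\<^sup>2) powr (p / 2)) > 0"
    using l by (intro sum_pos2[of _ l]) auto
  then have "psum_dist p n d x y \<noteq> 0"
    using psum_dist_powr[OF assms(4), of n d x y] by force
  then show ?thesis
    by (simp add: psum_dist_def psum_norm_def)
qed

lemma square_sum_ratio_powr:
  assumes "psum_dist p n d x y = r" "r > 0" "p > 0"
  shows "(\<Sum>l<n. (1 / r\<^sup>2 * (\<Sum>t<d l. (x l t - y l t)\<^sup>2)) powr (p / 2)) = 1"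
proof -
  have "(1 / r\<^sup>2) powr (p / 2) = 1 / r powr p"
    using assms(2,3) powr_powr[of r 2 "p / 2"] by (simp add: powr_divide)
  then have "(\<Sum>l<n. (1 / r\<^sup>2 * (\<Sum>t<d l. (x l t - y l t)\<^sup>2)) powr (p / 2)) =
      (\<Sum>l<n. (\<Sum>t<d l. (x l t - y l t)\<^sup>2) powr (p / 2)) / r powr p"
    by (simp only: powr_mult sum_divide_distrib) simp
  also have "\<dots> = 1"
    using psum_dist_powr[OF assms(3), of n d x y, symmetric] assms by simp
  finally show ?thesis .
qed

section \<open>The rank argument and the choice of the degree\<close>

text \<open>With m = card T and \<delta> = n \<epsilon>, the matrix \<open>B\<close> is within
  \<delta> of the identity on \<open>T\<close>, where \<delta> sqrt m <= 1/2. Its trace is at least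
  m/2, its squared entries sum to at most 5m/2, and its columns lie in the span of \<open>G\<close>;
  the trace inequality gives m <= 10 card G.\<close>

lemma card_equilateral_le:
  assumes Q: "degree Q \<le> k" "\<And>s. s \<in> {0..1} \<Longrightarrow> \<bar>s powr (p / 2) - poly Q s\<bar> \<le> \<epsilon>"
    and T: "finite T" "T \<noteq> {}"
    and r: "r > 0" "\<And>x y. x \<in> T \<Longrightarrow> y \<in> T \<Longrightarrow> x \<noteq> y \<Longrightarrow> psum_dist p n d x y = r"
    and d: "\<And>l. l < n \<Longrightarrow> d l \<le> a" and "n \<ge> 1" "p > 0"
    and small: "real n * \<epsilon> * (2 * sqrt (real (card T))) \<le> 1"
  shows "card T \<le> 10 * n * (2 * k + 1) ^ a"
proof -
  define m where "m = real (card T)"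
  define \<delta> where "\<delta> = real n * \<epsilon>"
  define s where "s x y l = 1 / r\<^sup>2 * (\<Sum>t<d l. (x l t - y l t)\<^sup>2)" for x y :: "nat \<Rightarrow> nat \<Rightarrow> real" and l
  define B where "B x y = 1 - (\<Sum>l<n. poly Q (s x y l))" for x y
  \<comment> \<open>One copy of the monomials for each of the n blocks.\<close>
  define G where "G = (\<Union>l<n. (\<lambda>g x. g (x l)) ` grid_monomials a (2 * k))"
  have m: "m \<ge> 1"
    using T by (simp add: m_def Suc_leI card_gt_0_iff)
  have "\<epsilon> \<ge> 0" using Q(2)[of 0] by simp
  then have \<delta>: "\<delta> \<ge> 0" by (simp add: \<delta>_def)
  have \<delta>m: "\<delta> * sqrt m \<le> 1 / 2"
    using small by (simp add: \<delta>_def m_def)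
  have "\<delta> * 1 \<le> \<delta> * sqrt m"
    using \<delta> m by (intro mult_left_mono) auto
  with \<delta>m have \<delta>_half: "\<delta> \<le> 1 / 2" by simp
  have finG: "finite G"
    by (simp add: G_def finite_grid_monomials)
  have cardG: "card G \<le> n * (2 * k + 1) ^ a"
  proof -
    have "card G \<le> (\<Sum>l<n. card ((\<lambda>g (x :: nat \<Rightarrow> nat \<Rightarrow> real). g (x l)) ` grid_monomials a (2 * k)))"
      unfolding G_def by (rule card_UN_le) simp
    also have "\<dots> \<le> (\<Sum>l<n. (2 * k + 1) ^ a)"
      using card_grid_monomials_le[of a "2 * k"]
      by (intro sum_mono order.trans[OF card_image_le] finite_grid_monomials) simp
    finally show ?thesis by simp
  qed
  have B_span: "(\<lambda>x. B x y) \<in> fun_span G" for y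
  proof -
    have lift: "(\<lambda>x. f (x l)) \<in> fun_span G" if "f \<in> fun_span (grid_monomials a (2 * k))" "l < n" for f l
      using that(1) finG by (rule fun_span_comp) (use that(2) in \<open>auto simp: G_def\<close>)
    \<comment> \<open>The constant 1 is a monomial of block 0, which exists as n >= 1, so it costs
      no further generator.\<close>
    have "(\<lambda>x. 1) \<in> fun_span G"
      using lift[OF fun_span_base[OF finite_grid_monomials one_in_grid_monomials], of 0] \<open>n \<ge> 1\<close> by simp
    moreover have "(\<lambda>x. \<Sum>l<n. poly Q (s x y l)) \<in> fun_span G"
    proof (rule fun_span_sum)
      fix l assume "l \<in> {..<n}"
      then have l: "l < n" by simp
      show "(\<lambda>x. poly Q (s x y l)) \<in> fun_span G"
        unfolding s_def by (rule lift[OF fun_span_grid_poly_square_distance[OF d[OF l] Q(1)] l])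
    qed
    ultimately show ?thesis
      using fun_span_add[of "\<lambda>x. 1" G, OF _ fun_span_scale[of _ G "-1"]] by (simp add: B_def)
  qed
  have s0: "s x y l \<ge> 0" for x y l
    by (simp add: s_def sum_nonneg)
  have close: "\<bar>(\<Sum>l<n. s x y l powr (p / 2)) - (\<Sum>l<n. poly Q (s x y l))\<bar> \<le> \<delta>"
    if "\<And>l. l < n \<Longrightarrow> s x y l \<le> 1" for x y
  proof -
    have "\<bar>\<Sum>l<n. s x y l powr (p / 2) - poly Q (s x y l)\<bar> \<le>
        (\<Sum>l<n. \<bar>s x y l powr (p / 2) - poly Q (s x y l)\<bar>)"
      by (rule sum_abs)
    also have "\<dots> \<le> (\<Sum>l<n. \<epsilon>)"
      using that s0 by (intro sum_mono Q(2)) auto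
    finally show ?thesis by (simp add: sum_subtractf \<delta>_def)
  qed
  \<comment> \<open>Every \<open>s x x l\<close> is 0, and so are its powers.\<close>
  have diag: "\<bar>B x x - 1\<bar> \<le> \<delta>" for x
    using close[of x x] \<open>p > 0\<close> by (simp add: B_def s_def)
  have offdiag: "\<bar>B x y\<bar> \<le> \<delta>" if "x \<in> T" "y \<in> T" "x \<noteq> y" for x y
  proof -
    have one: "(\<Sum>l<n. s x y l powr (p / 2)) = 1"
      unfolding s_def using r that \<open>p > 0\<close> by (intro square_sum_ratio_powr) auto
    \<comment> \<open>\<open>Q\<close> is controlled on [0, 1] only. The powers are nonnegative and
      sum to 1, so none exceeds 1.\<close>
    have "s x y l \<le> 1" if "l < n" for l
    proof (rule ccontr)
      assume "\<not> s x y l \<le> 1"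
      then have "1 < s x y l powr (p / 2)" using \<open>p > 0\<close> by simp
      also have "\<dots> \<le> (\<Sum>l<n. s x y l powr (p / 2))"
        using that by (intro member_le_sum) auto
      finally show False using one by simp
    qed
    from close[OF this] show ?thesis by (simp add: B_def one)
  qed
  have "m * (1 / 2) = (\<Sum>x\<in>T. 1 / 2)" by (simp add: m_def)
  also have "\<dots> \<le> (\<Sum>x\<in>T. B x x)"
    using diag \<delta>_half by (intro sum_mono) (smt (verit) field_sum_of_halves)
  finally have "(m * (1 / 2))\<^sup>2 \<le> (\<Sum>x\<in>T. B x x)\<^sup>2"
    using m by (intro power_mono) auto
  also have "\<dots> \<le> real (card G) * (\<Sum>y\<in>T. \<Sum>x\<in>T. (B x y)\<^sup>2)"
    by (rule trace_square_le[OF finG T(1) B_span])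
  \<comment> \<open>Each column contributes at most 9/4 on the diagonal and m \<delta>^2 <= 1/4 off
    it.\<close>
  also have "(\<Sum>y\<in>T. \<Sum>x\<in>T. (B x y)\<^sup>2) \<le> (\<Sum>y\<in>T. 5 / 2)"
  proof (rule sum_mono)
    fix y assume y: "y \<in> T"
    have "(\<Sum>x\<in>T. (B x y)\<^sup>2) = (B y y)\<^sup>2 + (\<Sum>x\<in>T - {y}. (B x y)\<^sup>2)"
      using T(1) y by (rule sum.remove)
    also have "(B y y)\<^sup>2 \<le> (3 / 2)\<^sup>2"
      using diag[of y] \<delta>_half by (intro power2_le_iff_abs_le[THEN iffD2]) auto
    also have "(\<Sum>x\<in>T - {y}. (B x y)\<^sup>2) \<le> (\<Sum>x\<in>T - {y}. \<delta>\<^sup>2)"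
      using offdiag y \<delta> by (intro sum_mono power2_le_iff_abs_le[THEN iffD2]) auto
    also have "\<dots> \<le> (\<Sum>x\<in>T. \<delta>\<^sup>2)"
      using T(1) by (intro sum_mono2) auto
    also have "\<dots> = (\<delta> * sqrt m)\<^sup>2"
      using m by (simp add: power_mult_distrib m_def)
    also have "\<dots> \<le> (1 / 2)\<^sup>2"
      using \<delta>m \<delta> m by (intro power_mono) auto
    finally show "(\<Sum>x\<in>T. (B x y)\<^sup>2) \<le> 5 / 2"
      by (simp add: power2_eq_square)
  qed
  also have "(\<Sum>y\<in>T. 5 / 2) = 5 / 2 * m" by (simp add: m_def)
  finally have "m * m \<le> (10 * real (card G)) * m"
    by (simp add: power2_eq_square mult_left_mono)
  then have "m \<le> 10 * real (card G)"
    using m by simp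
  then have "card T \<le> 10 * card G"
    unfolding m_def by linarith
  with cardG show ?thesis by simp
qed

text \<open>On the right m has exponent a/(2p) < 1, so its power can be moved to the left, where a
  positive power of m remains.\<close>

lemma powr_self_bound:
  fixes m K p :: real and n a :: nat
  assumes "m > 0" "n \<ge> 1" "K > 0" "p > 0" "2 * p > real a"
    and "m \<le> K * n * (n * sqrt m) powr (a / p)"
  shows "m \<le> K powr (2 * p / (2 * p - a)) * n powr ((2 * p + 2 * real a) / (2 * p - real a))"
proof -
  \<comment> \<open>The reciprocal of the remaining exponent 1 - a/(2p).\<close>
  define q where "q = 2 * p / (2 * p - a)"
  have q: "q > 0" using assms by (simp add: q_def)
  have pos: "m powr (a / (2 * p)) > 0" using assms by simp
  have "(n * sqrt m) powr (a / p) = n powr (a / p) * m powr (a / (2 * p))"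
    using assms by (simp add: powr_mult powr_powr flip: powr_half_sqrt)
  then have "m \<le> K * n powr (1 + a / p) * m powr (a / (2 * p))"
    using assms by (simp add: powr_add mult_ac)
  then have "m / m powr (a / (2 * p)) \<le> K * n powr (1 + a / p)"
    using pos by (simp add: pos_divide_le_eq)
  then have "m powr (1 - a / (2 * p)) \<le> K * n powr (1 + a / p)"
    using assms(1) by (simp add: powr_diff)
  then have "(m powr (1 - a / (2 * p))) powr q \<le> (K * n powr (1 + a / p)) powr q"
    using q by (intro powr_mono2) auto
  moreover have "(1 - a / (2 * p)) * q = 1" "(1 + a / p) * q = (2 * p + 2 * real a) / (2 * p - real a)"
    using assms by (auto simp: q_def field_simps)
  ultimately show ?thesis
    using assms by (simp add: powr_powr powr_mult q_def)
qed

lemma card_equilateral_le_powr: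
  assumes p: "p > 0" "2 * p > real a" and C: "C \<ge> 1"
    "\<And>k. k \<ge> 1 \<Longrightarrow> \<exists>Q :: real poly. degree Q \<le> k \<and>
       (\<forall>s\<in>{0..1}. \<bar>s powr (p / 2) - poly Q s\<bar> \<le> C * real k powr - p)"
    and T: "finite T" "T \<noteq> {}"
    and r: "r > 0" "\<And>x y. x \<in> T \<Longrightarrow> y \<in> T \<Longrightarrow> x \<noteq> y \<Longrightarrow> psum_dist p n d x y = r"
    and d: "\<And>l. l < n \<Longrightarrow> d l \<le> a" and n: "n \<ge> 1"
  shows "real (card T) \<le> (10 * 6 ^ a * (2 * C) powr (a / p)) powr (2 * p / (2 * p - a)) *
           real n powr ((2 * p + 2 * real a) / (2 * p - real a))"
proof (rule powr_self_bound)
  define m where "m = real (card T)"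
  have m: "m \<ge> 1"
    using T by (simp add: m_def Suc_leI card_gt_0_iff)
  \<comment> \<open>With this \<open>u\<close>, the smallness condition for \<epsilon> = C k^(-p)
    reads u k^(-p) <= 1, that is k >= u^(1/p).\<close>
  define u where "u = 2 * C * (n * sqrt m)"
  have "1 * 1 \<le> real n * sqrt m"
    using n m by (intro mult_mono) auto
  then have "1 * 1 \<le> 2 * C * (n * sqrt m)"
    using C(1) by (intro mult_mono) auto
  then have u: "u \<ge> 1" by (simp add: u_def)
  define k where "k = nat \<lceil>u powr (1 / p)\<rceil>"
  have u1: "u powr (1 / p) \<ge> 1" using u p by (simp add: ge_one_powr_ge_zero)
  have k: "real k \<ge> u powr (1 / p)" "real k \<le> u powr (1 / p) + 1"
    using u1 unfolding k_def by linarith+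
  then have k1: "k \<ge> 1" using u1 by simp
  obtain Q :: "real poly" where Q: "degree Q \<le> k"
    "\<And>s. s \<in> {0..1} \<Longrightarrow> \<bar>s powr (p / 2) - poly Q s\<bar> \<le> C * real k powr - p"
    using C(2)[OF k1] by blast
  have "u = (u powr (1 / p)) powr p" using u p by (simp add: powr_powr)
  also have "\<dots> \<le> real k powr p" using k p by (intro powr_mono2) auto
  finally have "u * real k powr - p \<le> real k powr p * real k powr - p"
    by (intro mult_right_mono) auto
  also have "\<dots> = 1" using k1 by (simp flip: powr_add)
  finally have small: "real n * (C * real k powr - p) * (2 * sqrt (real (card T))) \<le> 1"
    by (simp add: u_def m_def mult_ac)
  have "card T \<le> 10 * n * (2 * k + 1) ^ a"
    by (rule card_equilateral_le[OF Q T r d n p(1) small])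
  then have "m \<le> 10 * real n * (2 * real k + 1) ^ a"
    unfolding m_def by (metis (mono_tags) of_nat_1 of_nat_add of_nat_le_iff of_nat_mult of_nat_numeral of_nat_power)
  \<comment> \<open>Since u^(1/p) >= 1, 2 k + 1 <= 2 u^(1/p) + 3 <= 6 u^(1/p).\<close>
  also have "\<dots> \<le> 10 * real n * (6 * u powr (1 / p)) ^ a"
    using k u1 by (intro mult_left_mono power_mono) auto
  also have "(6 * u powr (1 / p)) ^ a = 6 ^ a * u powr (a / p)"
    using u by (simp add: power_mult_distrib powr_powr flip: powr_realpow)
  also have "u powr (a / p) = (2 * C) powr (a / p) * (n * sqrt m) powr (a / p)"
    using C(1) by (simp add: u_def powr_mult)
  finally show "real (card T) \<le> 10 * 6 ^ a * (2 * C) powr (a / p) * n *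
      (n * sqrt (real (card T))) powr (a / p)"
    by (simp add: m_def mult_ac)
  show "real (card T) > 0" using T by (simp add: card_gt_0_iff)
  show "10 * 6 ^ a * (2 * C) powr (a / p) > 0" using C(1) by simp
qed (use p n in auto)

theorem theorem6:
  fixes a :: nat and p :: real
  assumes "a \<ge> 1" and "1 \<le> p" and "2 * p > real a"
  shows "\<exists>c::real. \<forall>(n::nat) (d::nat \<Rightarrow> nat).
           n \<ge> 1 \<and> (\<forall>i<n. d i \<ge> 1) \<and> Max (d ` {..<n}) = a \<longrightarrow>
           equilateral_number_le (psum_carrier n d) (psum_dist p n d)
             (c * real n powr ((2 * p + 2 * real a) / (2 * p - real a)))"
proof -
  have p: "p > 0" using assms by simp
  obtain C where C: "C \<ge> 1"
    "\<And>k. k \<ge> 1 \<Longrightarrow> \<exists>Q :: real poly. degree Q \<le> k \<and>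
       (\<forall>s\<in>{0..1}. \<bar>s powr (p / 2) - poly Q s\<bar> \<le> C * real k powr - p)"
    using powr_approx_polynomial[of "p / 2"] p by auto
  \<comment> \<open>\<open>C\<close> was obtained from p alone, so \<open>c\<close> depends on p and
    a only.\<close>
  define c where "c = (10 * 6 ^ a * (2 * C) powr (a / p)) powr (2 * p / (2 * p - real a))"
  have "finite S \<and> real (card S) \<le> c * real n powr ((2 * p + 2 * real a) / (2 * p - real a))"
    if n: "n \<ge> 1" and d: "Max (d ` {..<n}) = a"
      and S: "S \<subseteq> psum_carrier n d" "equilateral (psum_dist p n d) S" for n d S
  proof -
    let ?b = "c * real n powr ((2 * p + 2 * real a) / (2 * p - real a))"
    have d_le: "d l \<le> a" if "l < n" for l
      using d that by (metis Max_ge finite_imageI finite_lessThan imageI lessThan_iff)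
    \<comment> \<open>The rescaling by r requires r > 0. Two distinct points force this; with at
      most one point the condition on distances is vacuous and r = 1 serves.\<close>
    obtain r where r: "r > 0" "\<And>x y. x \<in> S \<Longrightarrow> y \<in> S \<Longrightarrow> x \<noteq> y \<Longrightarrow> psum_dist p n d x y = r"
    proof (cases "\<exists>x\<in>S. \<exists>y\<in>S. x \<noteq> y")
      case True
      then obtain x y where xy: "x \<in> S" "y \<in> S" "x \<noteq> y" by blast
      obtain r where r: "\<forall>x\<in>S. \<forall>y\<in>S. x \<noteq> y \<longrightarrow> psum_dist p n d x y = r"
        using S(2) unfolding equilateral_def by blast
      have "psum_dist p n d x y > 0"
        using xy S(1) p by (intro psum_dist_pos) auto
      then show ?thesis using r xy that by metis
    next
      case False
      then show ?thesis using that[of 1] by auto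
    qed
    \<comment> \<open>Finite subsets come first: an infinite \<open>S\<close> would contain a finite
      subset larger than this uniform bound.\<close>
    have bound: "real (card T) \<le> ?b" if "finite T" "T \<subseteq> S" for T
    proof (cases "T = {}")
      case True
      then show ?thesis by (simp add: c_def)
    next
      case False
      show ?thesis
        unfolding c_def
        by (rule card_equilateral_le_powr[where d = d and n = n, OF p assms(3) C that(1) False r(1)])
           (use that(2) r(2) d_le n in blast)+
    qed
    have "finite S"
    proof (rule ccontr)
      assume "infinite S"
      then obtain T where T: "T \<subseteq> S" "finite T" "card T = nat \<lceil>?b\<rceil> + 1"
        using infinite_arbitrarily_large[of S "nat \<lceil>?b\<rceil> + 1"] by blast
      then show False using bound[of T] real_nat_ceiling_ge[of ?b] by simp
    qed
    with bound show ?thesis by blast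
  qed
  then show ?thesis
    unfolding equilateral_number_le_def by blast
qed

end
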